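(* Let $X$ be a real Hilbert space, let $T\colon X\to X$ be firmly nonexpansive, let $A\colon X\rightrightarrows X$ be maximally monotone, and suppose that $T=J_A$, or equivalently that $A=T^{-1}-\mathrm{Id}$. Then the following are equivalent: (i) $T$ is affine. (ii) $A$ is an affine relation. (iii) $\mathrm{Id}-T$ is affine. (iv) $A^{-1}$ is an affine relation. Consequently, affineness is a self-dual property for firmly nonexpansive mappings; correspondingly, being an affine relation is a self-dual property for maximally monotone operators.
   Context: $X$ is a real Hilbert space; $\mathrm{Id}$ is the identity on $X$. $T\colon X\to X$ is firmly nonexpansive if $\|Tx-Ty\|^2+\|(\mathrm{Id}-T)x-(\mathrm{Id}-T)y\|^2\leq\|x-y\|^2$ for all $x,y\in X$. For $A\colon X\rightrightarrows X$ (so $Ax\subseteq X$ for each $x$): $\operatorname{gr}A=\{(x,u):u\in Ax\}$ and $x\in A^{-1}u\Leftrightarrow u\in Ax$. $A$ is monotone if $\langle x-y,u-v\rangle\geq0$ for all $(x,u),(y,v)\in\operatorname{gr}A$, and maximally monotone if it is monotone with no proper monotone extension. $A$ is an affine relation if $\operatorname{gr}A$ is an affine subspace of $X\times X$. The resolvent of a maximally monotone $A$ is $J_A=(\mathrm{Id}+A)^{-1}\colon X\to X$. A property of firmly nonexpansive mappings on $X$ is self-dual if, for every firmly nonexpansive $T\colon X\to X$, $T$ has it if and only if $\mathrm{Id}-T$ has it; a property of maximally monotone operators on $X$ is self-dual if, for every maximally monotone $A$, $A$ has it if and only if $A^{-1}$ has it. *)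

theory Defs
  imports "HOL-Analysis.Analysis"
begin

text \<open>
  A set-valued operator on a space \<open>'a\<close> is a function of type \<open>'a \<Rightarrow> 'a set\<close>.
\<close>

definition gr :: "('a \<Rightarrow> 'a set) \<Rightarrow> ('a \<times> 'a) set" where
  "gr A = {(x, u). u \<in> A x}"

definition op_inverse :: "('a \<Rightarrow> 'a set) \<Rightarrow> 'a \<Rightarrow> 'a set" where
  "op_inverse A = (\<lambda>u. {x. u \<in> A x})"

definition op_of :: "('a \<Rightarrow> 'a) \<Rightarrow> 'a \<Rightarrow> 'a set" where
  "op_of T = (\<lambda>x. {T x})"

definition op_add :: "('a::real_vector \<Rightarrow> 'a set) \<Rightarrow> ('a \<Rightarrow> 'a set) \<Rightarrow> 'a \<Rightarrow> 'a set" where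
  "op_add A B = (\<lambda>x. {u + v | u v. u \<in> A x \<and> v \<in> B x})"

definition op_diff :: "('a::real_vector \<Rightarrow> 'a set) \<Rightarrow> ('a \<Rightarrow> 'a set) \<Rightarrow> 'a \<Rightarrow> 'a set" where
  "op_diff A B = (\<lambda>x. {u - v | u v. u \<in> A x \<and> v \<in> B x})"

definition monotone_operator :: "('a::real_inner \<Rightarrow> 'a set) \<Rightarrow> bool" where
  "monotone_operator A \<longleftrightarrow>
     (\<forall>(x, u) \<in> gr A. \<forall>(y, v) \<in> gr A. (x - y) \<bullet> (u - v) \<ge> 0)"

definition maximally_monotone :: "('a::real_inner \<Rightarrow> 'a set) \<Rightarrow> bool" where
  "maximally_monotone A \<longleftrightarrow>
     monotone_operator A \<and> (\<nexists>B. monotone_operator B \<and> gr A \<subset> gr B)"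

text \<open>
  The resolvent is kept set-valued, so that it is defined for every operator. For maximally
  monotone \<open>A\<close> it is single-valued with full domain; that a function \<open>T\<close> equals the resolvent
  of \<open>A\<close> is written \<open>op_of T = resolvent A\<close>.
\<close>

definition resolvent :: "('a::real_vector \<Rightarrow> 'a set) \<Rightarrow> 'a \<Rightarrow> 'a set" where
  "resolvent A = op_inverse (op_add (op_of id) A)"

definition firmly_nonexpansive :: "('a::real_normed_vector \<Rightarrow> 'a) \<Rightarrow> bool" where
  "firmly_nonexpansive T \<longleftrightarrow>
     (\<forall>x y. (norm (T x - T y))\<^sup>2 + (norm ((x - T x) - (y - T y)))\<^sup>2 \<le> (norm (x - y))\<^sup>2)"

definition affine_map :: "('a::real_vector \<Rightarrow> 'b::real_vector) \<Rightarrow> bool" where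
  "affine_map T \<longleftrightarrow>
     (\<forall>x y u v. u + v = 1 \<longrightarrow> T (u *\<^sub>R x + v *\<^sub>R y) = u *\<^sub>R T x + v *\<^sub>R T y)"

text \<open>
  \<^const>\<open>affine\<close> also holds of the empty set. This makes no difference for maximally monotone
  operators, whose graph is never empty.
\<close>

definition affine_relation :: "('a::real_vector \<Rightarrow> 'a set) \<Rightarrow> bool" where
  "affine_relation A \<longleftrightarrow> affine (gr A)"

definition self_dual_firmly_nonexpansive ::
  "(('a::real_normed_vector \<Rightarrow> 'a) \<Rightarrow> bool) \<Rightarrow> bool" where
  "self_dual_firmly_nonexpansive P \<longleftrightarrow>
     (\<forall>T. firmly_nonexpansive T \<longrightarrow> (P T \<longleftrightarrow> P (\<lambda>x. x - T x)))"

definition self_dual_maximally_monotone ::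
  "(('a::real_inner \<Rightarrow> 'a set) \<Rightarrow> bool) \<Rightarrow> bool" where
  "self_dual_maximally_monotone P \<longleftrightarrow>
     (\<forall>A. maximally_monotone A \<longrightarrow> (P A \<longleftrightarrow> P (op_inverse A)))"

end

theory Submission
  imports Defs
begin

text \<open>Both \<open>T = J_A\<close> and \<open>A = T^{-1} - Id\<close> unfold to one pointwise
  condition: \<open>u \<in> A x\<close> iff \<open>T (x + u) = x\<close>. It says that the linear
  bijection \<open>(z, p) \<mapsto> (p, z - p)\<close> of the product space carries the graph of
  \<open>T\<close> onto \<open>gr A\<close>. Linear bijections preserve affine sets, so
  \<open>T\<close> is affine exactly when \<open>gr A\<close> is; this is
  \<open>affine_map_iff_affine_relation\<close>. Passing from \<open>T\<close> to
  \<open>Id - T\<close> subtracts from the linear identity, and passing from \<open>A\<close> to its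
  inverse swaps the two coordinates of the graph. Both operations are involutions that preserve
  affineness, which gives the remaining equivalences and the two self-duality claims.\<close>

lemma resolvent_iff_graph:
  fixes T :: "'a::real_vector \<Rightarrow> 'a"
  shows "op_of T = resolvent A \<longleftrightarrow> (\<forall>x u. u \<in> A x \<longleftrightarrow> T (x + u) = x)"
proof
  assume eq: "op_of T = resolvent A"
  show "\<forall>x u. u \<in> A x \<longleftrightarrow> T (x + u) = x"
  proof (intro allI)
    fix x u
    have "x \<in> op_of T (x + u) \<longleftrightarrow> x \<in> resolvent A (x + u)"
      using eq by simp
    then show "u \<in> A x \<longleftrightarrow> T (x + u) = x"
      by (auto simp: op_of_def resolvent_def op_inverse_def op_add_def)
  qed
next
  assume R: "\<forall>x u. u \<in> A x \<longleftrightarrow> T (x + u) = x"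
  show "op_of T = resolvent A"
  proof (intro ext set_eqI)
    fix z p
    \<comment> \<open>The decomposition \<open>z = p + u\<close> with \<open>u \<in> A p\<close>
      forces \<open>u = z - p\<close>.\<close>
    have "p \<in> resolvent A z \<longleftrightarrow> z - p \<in> A p"
      by (force simp: op_of_def resolvent_def op_inverse_def op_add_def)
    also have "\<dots> \<longleftrightarrow> p \<in> op_of T z"
      using R by (auto simp: op_of_def)
    finally show "p \<in> op_of T z \<longleftrightarrow> p \<in> resolvent A z" ..
  qed
qed

text \<open>The right-hand side is the same condition as in \<open>resolvent_iff_graph\<close>, so
  the two descriptions of the link between \<open>T\<close> and \<open>A\<close> are
  interchangeable.\<close>

lemma inverse_minus_id_iff_graph:
  fixes T :: "'a::real_vector \<Rightarrow> 'a"
  shows "A = op_diff (op_inverse (op_of T)) (op_of id) \<longleftrightarrow>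
         (\<forall>x u. u \<in> A x \<longleftrightarrow> T (x + u) = x)"
proof -
  have "u \<in> op_diff (op_inverse (op_of T)) (op_of id) x \<longleftrightarrow> T (x + u) = x" for x u
  proof -
    have "u \<in> op_diff (op_inverse (op_of T)) (op_of id) x \<longleftrightarrow> (\<exists>w. u = w - x \<and> x = T w)"
      by (simp add: op_of_def op_inverse_def op_diff_def)
    \<comment> \<open>The only possible witness is \<open>w = x + u\<close>.\<close>
    also have "\<dots> \<longleftrightarrow> T (x + u) = x"
      by (metis add_diff_cancel_left' add.commute diff_add_cancel)
    finally show ?thesis .
  qed
  then show ?thesis
    by (auto simp: fun_eq_iff set_eq_iff)
qed

text \<open>Under \<open>R\<close>, the points of \<open>gr A\<close> are exactly the pairs
  \<open>(T z, z - T z)\<close>, where \<open>z\<close> is recovered as the sum of the two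
  coordinates.\<close>

lemma affine_map_iff_affine_relation:
  fixes T :: "'a::real_vector \<Rightarrow> 'a"
  assumes R: "\<And>x u. u \<in> A x \<longleftrightarrow> T (x + u) = x"
  shows "affine_map T \<longleftrightarrow> affine_relation A"
proof
  assume T: "affine_map T"
  show "affine_relation A"
    unfolding affine_relation_def affine_def
  proof (clarsimp simp: gr_def R)
    fix x u y v and s t :: real
    assume "T (x + u) = x" "T (y + v) = y" "s + t = 1"
    \<comment> \<open>Adding the coordinates of a pair is linear, so the argument of
      \<open>T\<close> is the same affine combination of \<open>x + u\<close> and
      \<open>y + v\<close>.\<close>
    moreover have "s *\<^sub>R x + t *\<^sub>R y + (s *\<^sub>R u + t *\<^sub>R v) = s *\<^sub>R (x + u) + t *\<^sub>R (y + v)"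
      by (simp add: algebra_simps)
    ultimately show "T (s *\<^sub>R x + t *\<^sub>R y + (s *\<^sub>R u + t *\<^sub>R v)) = s *\<^sub>R x + t *\<^sub>R y"
      using T by (simp add: affine_map_def)
  qed
next
  assume A: "affine_relation A"
  show "affine_map T"
    unfolding affine_map_def
  proof (intro allI impI)
    fix x y and s t :: real
    assume st: "s + t = 1"
    have "(T z, z - T z) \<in> gr A" for z
      by (simp add: gr_def R)
    then have "s *\<^sub>R (T x, x - T x) + t *\<^sub>R (T y, y - T y) \<in> gr A"
      using A st unfolding affine_relation_def affine_def by blast
    \<comment> \<open>The coordinates of the combined point add up to
      \<open>s *\<^sub>R x + t *\<^sub>R y\<close>, and its first one is the required value, so
      \<open>R\<close> reads off the claim.\<close>
    then show "T (s *\<^sub>R x + t *\<^sub>R y) = s *\<^sub>R T x + t *\<^sub>R T y"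
      by (simp add: gr_def R algebra_simps)
  qed
qed

lemma affine_map_id_minus:
  fixes T :: "'a::real_vector \<Rightarrow> 'a"
  assumes "affine_map T"
  shows "affine_map (\<lambda>x. x - T x)"
  using assms by (simp add: affine_map_def algebra_simps)

text \<open>The converse is the forward direction applied to \<open>Id - T\<close>, since
  \<open>Id - (Id - T) = T\<close>.\<close>

lemma affine_map_id_minus_iff:
  fixes T :: "'a::real_vector \<Rightarrow> 'a"
  shows "affine_map T \<longleftrightarrow> affine_map (\<lambda>x. x - T x)"
  using affine_map_id_minus[of T] affine_map_id_minus[of "\<lambda>x. x - T x"] by auto

text \<open>The coordinate swap is linear and exchanges \<open>gr A\<close> with the graph of the
  inverse.\<close>

lemma affine_relation_op_inverse_iff:
  "affine_relation A \<longleftrightarrow> affine_relation (op_inverse A)"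
  by (fastforce simp: affine_relation_def affine_def gr_def op_inverse_def)

theorem theorem3p16:
  shows "(\<forall>(T :: 'a::{real_inner, complete_space} \<Rightarrow> 'a) A.
            firmly_nonexpansive T \<and> maximally_monotone A \<longrightarrow>
              (op_of T = resolvent A \<longleftrightarrow> A = op_diff (op_inverse (op_of T)) (op_of id)) \<and>
              (op_of T = resolvent A \<longrightarrow>
                 (affine_map T \<longleftrightarrow> affine_relation A) \<and>
                 (affine_map T \<longleftrightarrow> affine_map (\<lambda>x. x - T x)) \<and>
                 (affine_map T \<longleftrightarrow> affine_relation (op_inverse A))))
         \<and> self_dual_firmly_nonexpansive (affine_map :: ('a \<Rightarrow> 'a) \<Rightarrow> bool)
         \<and> self_dual_maximally_monotone (affine_relation :: ('a \<Rightarrow> 'a set) \<Rightarrow> bool)"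
proof (intro conjI allI impI)
  fix T :: "'a \<Rightarrow> 'a" and A
  show "op_of T = resolvent A \<longleftrightarrow> A = op_diff (op_inverse (op_of T)) (op_of id)"
    by (simp only: resolvent_iff_graph inverse_minus_id_iff_graph)
  show "affine_map T \<longleftrightarrow> affine_map (\<lambda>x. x - T x)"
    by (rule affine_map_id_minus_iff)
  assume "op_of T = resolvent A"
  then show TA: "affine_map T \<longleftrightarrow> affine_relation A"
    by (intro affine_map_iff_affine_relation) (simp add: resolvent_iff_graph)
  then show "affine_map T \<longleftrightarrow> affine_relation (op_inverse A)"
    by (simp only: affine_relation_op_inverse_iff[symmetric])
next
  show "self_dual_firmly_nonexpansive (affine_map :: ('a \<Rightarrow> 'a) \<Rightarrow> bool)"
    unfolding self_dual_firmly_nonexpansive_def using affine_map_id_minus_iff by blast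
  show "self_dual_maximally_monotone (affine_relation :: ('a \<Rightarrow> 'a set) \<Rightarrow> bool)"
    unfolding self_dual_maximally_monotone_def using affine_relation_op_inverse_iff by blast
qed

end
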